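(* Let the function $\mu(x)=x^\gamma\ell(x)$ satisfy Assumption B (see context), let $\mu_n=\mu(n)$, $\ell_n=\ell(n)$, and let $p=p_c$. Then $$a_n^2\mu_n^2\sim C_\mu\,\frac{\ell_n^{1/(\gamma+1)}}{n},$$ with $C_\mu$ a positive constant depending on the memory sequence $\{\mu_n\}$. Further, if $\int_1^\infty f(s)^{1/(\gamma+1)}ds=\infty$, where $\ell(x)=f(\log x)$, then we also have $$v_n^2\sim C_\mu\int_1^{\log n}f(s)^{\frac1{\gamma+1}}ds\qquad\text{and}\qquad\sigma_n^2\sim n\,\ell_n^{-\frac1{\gamma+1}}\int_1^{\log n}f(s)^{\frac1{\gamma+1}}ds.$$
   Context: Notation. $p_c=(\gamma+\frac12)/(\gamma+1)$, where $p=p_c\in[0,1]$ is a recollection probability and $\gamma>-1$; $\nu_n=\sum_{k=1}^n\mu_k$; $a_n=\prod_{i=1}^{n-1}\left(1+p\frac{\mu_{i+1}}{\nu_i}\right)^{-1}$ for $n\ge1$ (so $a_1=1$); $v_n^2=\sum_{k=1}^na_k^2\mu_k^2$ ($v_n\ge0$); $\sigma_n=v_n/(a_n\mu_n)$. $x_n\sim y_n$ means $x_n/y_n\to1$. Assumption B. $\mu_n=\mu(n)$ for a function $\mu:[1,\infty)\to(0,\infty)$ that is eventually monotone and regularly varying of index $\gamma$, and $\mu(x)=x^\gamma\ell(x)$, where: (i) for some $B>1$, $\ell(x)=\exp\left(\int_{\log B}^{\log x}\delta(s)\,ds\right)$ for $x>B$; thus $\ell(x)=f(\log x)$ with $f(x)=\exp\left(\int_{\log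 B}^{x}\delta(s)\,ds\right)$ for $x>\log B$; (ii) $\delta$ is monotone decreasing to $0$ at infinity and integrable on $(\log B,x)$ for all finite $x$; (iii) $\int_{\log B}^\infty\delta(x)\,dx=\infty$ and $\delta$ is regularly varying of index $-\rho$ for some $\rho\in(0,1]$; moreover $\delta$ is differentiable at least $m$ times, where $m$ is an integer with $m\rho>1$, and, for $1\le k\le m$, the absolute value $|\delta^{(k)}|$ of the $k$-th derivative is regularly varying of index $-(\rho+k)$. *)

theory Defs
  imports "HOL-Analysis.Analysis" "HOL-Library.Landau_Symbols"
begin

text \<open>
  Regular variation at infinity: a measurable function, defined and positive on some
  half-line. The value outside that half-line is irrelevant.
\<close>

definition regularly_varying :: "(real \<Rightarrow> real) \<Rightarrow> real \<Rightarrow> bool" where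
  "regularly_varying g \<alpha> \<longleftrightarrow>
     (\<exists>X. g \<in> borel_measurable (lebesgue_on {X..}) \<and> (\<forall>x\<ge>X. g x > 0)) \<and>
     (\<forall>c>0. ((\<lambda>x. g (c * x) / g x) \<longlongrightarrow> c powr \<alpha>) at_top)"

text \<open>
  The statement that the integral of \<open>g\<close> over \<open>(a, \<infinity>)\<close> is \<open>\<infinity>\<close>: the integral over each
  bounded interval exists, and these integrals tend to infinity. Existence has to be
  demanded because \<open>integral\<close> is 0 by convention where it does not exist. All functions
  integrated below are nonnegative, so that the Henstock-Kurzweil and the Lebesgue integral
  agree, and the value at the end point \<open>a\<close> does not matter.
\<close>

definition integral_infinite :: "real \<Rightarrow> (real \<Rightarrow> real) \<Rightarrow> bool" where
  "integral_infinite a g \<longleftrightarrow>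
     (\<forall>x\<ge>a. g integrable_on {a..x}) \<and>
     filterlim (\<lambda>x. integral {a..x} g) at_top at_top"

text \<open>
  The functions \<open>\<mu>\<close> and \<open>l\<close> live on \<open>[1, \<infinity>)\<close>, \<open>f\<close> on \<open>[0, \<infinity>)\<close> and \<open>\<delta>\<close> on
  \<open>(ln B, \<infinity>)\<close>. On \<open>[0, ln B]\<close>, where no formula in terms of \<open>\<delta>\<close> is available,
  \<open>f\<close> is given by \<open>l x = f (ln x)\<close>.
\<close>

definition assumption_B ::
  "(real \<Rightarrow> real) \<Rightarrow> real \<Rightarrow> (real \<Rightarrow> real) \<Rightarrow> (real \<Rightarrow> real) \<Rightarrow>
   real \<Rightarrow> (real \<Rightarrow> real) \<Rightarrow> real \<Rightarrow> nat \<Rightarrow> bool" where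
  "assumption_B \<mu> \<gamma> l f B \<delta> \<rho> m \<longleftrightarrow>
     (\<forall>x\<ge>1. \<mu> x > 0) \<and>
     (\<exists>X. mono_on {X..} \<mu> \<or> antimono_on {X..} \<mu>) \<and>
     regularly_varying \<mu> \<gamma> \<and>
     (\<forall>x\<ge>1. \<mu> x = x powr \<gamma> * l x) \<and>
     (\<forall>x\<ge>1. l x = f (ln x)) \<and>
     B > 1 \<and>
     (\<forall>x>ln B. f x = exp (integral {ln B..x} \<delta>)) \<and>
     antimono_on {ln B<..} \<delta> \<and>
     (\<delta> \<longlongrightarrow> 0) at_top \<and>
     (\<forall>x>ln B. \<delta> integrable_on {ln B..x}) \<and>
     integral_infinite (ln B) \<delta> \<and>
     0 < \<rho> \<and> \<rho> \<le> 1 \<and>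
     regularly_varying \<delta> (- \<rho>) \<and>
     real m * \<rho> > 1 \<and>
     (\<forall>k<m. (deriv ^^ k) \<delta> differentiable_on {ln B<..}) \<and>
     (\<forall>k\<in>{1..m}. regularly_varying (\<lambda>x. \<bar>(deriv ^^ k) \<delta> x\<bar>) (- (\<rho> + real k)))"

definition p_crit :: "real \<Rightarrow> real" where
  "p_crit \<gamma> = (\<gamma> + 1/2) / (\<gamma> + 1)"

text \<open>
  The sequences below depend on a memory sequence, given as a function on \<open>nat\<close> of which
  only the values at positive indices are used, and on the recollection probability \<open>p\<close>.
\<close>

definition nu_seq :: "(nat \<Rightarrow> real) \<Rightarrow> nat \<Rightarrow> real" where
  "nu_seq mu n = (\<Sum>k=1..n. mu k)"

definition a_seq :: "(nat \<Rightarrow> real) \<Rightarrow> real \<Rightarrow> nat \<Rightarrow> real" where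
  "a_seq mu p n = (\<Prod>i=1..<n. inverse (1 + p * (mu (i + 1) / nu_seq mu i)))"

definition v_seq :: "(nat \<Rightarrow> real) \<Rightarrow> real \<Rightarrow> nat \<Rightarrow> real" where
  "v_seq mu p n = sqrt (\<Sum>k=1..n. (a_seq mu p k)\<^sup>2 * (mu k)\<^sup>2)"

definition sigma_seq :: "(nat \<Rightarrow> real) \<Rightarrow> real \<Rightarrow> nat \<Rightarrow> real" where
  "sigma_seq mu p n = v_seq mu p n / (a_seq mu p n * mu n)"

end

theory Submission
  imports Defs "HOL-Real_Asymp.Real_Asymp"
begin

text \<open>
  The logarithm of \<open>a\<^sub>n\<close> telescopes to \<open>- p ln \<nu>\<^sub>n\<close> up to a convergent series, because
  \<open>\<mu>\<^sub>i\<^sub>+\<^sub>1 / \<nu>\<^sub>i = O(1/i)\<close>. The Stolz--Cesaro theorem shows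
  \<open>\<nu>\<^sub>n \<sim> n \<mu>\<^sub>n / (\<gamma> + 1)\<close>, and \<open>p = p_crit \<gamma>\<close> makes the powers of \<open>n\<close> in
  \<open>a\<^sub>n\<^sup>2 \<mu>\<^sub>n\<^sup>2\<close> combine to \<open>1 / n\<close>. The sum of these terms is compared with the integral
  increment by increment, again by Stolz--Cesaro.
\<close>

text \<open>The increments of \<open>A - L * D\<close> are eventually at most \<open>e / 2\<close>
  times those of \<open>D\<close>. Telescoping from a fixed index leaves a constant plus
  \<open>e / 2 * D n\<close>, and the divergence of \<open>D\<close> absorbs the constant.\<close>

lemma stolz_cesaro:
  fixes A D :: "nat \<Rightarrow> real"
  assumes D: "filterlim D at_top sequentially"
    and incr: "eventually (\<lambda>n. D n < D (Suc n)) sequentially"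
    and lim: "(\<lambda>n. (A (Suc n) - A n) / (D (Suc n) - D n)) \<longlonglongrightarrow> L"
  shows "(\<lambda>n. A n / D n) \<longlonglongrightarrow> L"
proof (rule tendstoI)
  fix e :: real assume e: "e > 0"
  define E where "E n = A n - L * D n" for n
  have "eventually (\<lambda>n. dist ((A (Suc n) - A n) / (D (Suc n) - D n)) L < e / 2) sequentially"
    using lim e by (intro tendstoD) auto
  with incr have "eventually (\<lambda>n. \<bar>E (Suc n) - E n\<bar> \<le> e / 2 * (D (Suc n) - D n)) sequentially"
  proof eventually_elim
    case (elim n)
    define d where "d = D (Suc n) - D n"
    have d: "d > 0" using elim by (simp add: d_def)
    have "E (Suc n) - E n = ((A (Suc n) - A n) / d - L) * d"
      using d by (simp add: E_def d_def field_simps)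
    hence "\<bar>E (Suc n) - E n\<bar> = \<bar>(A (Suc n) - A n) / d - L\<bar> * d"
      using d by (simp add: abs_mult)
    also have "\<dots> \<le> e / 2 * d"
      using elim d by (intro mult_right_mono) (auto simp: dist_real_def d_def)
    finally show ?case by (simp add: d_def)
  qed
  then obtain N where N: "\<And>n. n \<ge> N \<Longrightarrow> \<bar>E (Suc n) - E n\<bar> \<le> e / 2 * (D (Suc n) - D n)"
    unfolding eventually_sequentially by blast
  have tele: "\<bar>E n - E N\<bar> \<le> e / 2 * (D n - D N)" if "n \<ge> N" for n
    using that
  proof (induction n rule: dec_induct)
    case (step n)
    have "\<bar>E (Suc n) - E N\<bar> \<le> \<bar>E (Suc n) - E n\<bar> + \<bar>E n - E N\<bar>"
      by linarith
    with step.IH N[OF step.hyps(1)] show ?case by (simp add: algebra_simps)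
  qed simp
  \<comment> \<open>The threshold makes the contribution of the fixed index \<open>N\<close> less
    than \<open>e / 2 * D n\<close>; the maximum with 0 keeps the denominator \<open>D n\<close>
    positive.\<close>
  have "eventually (\<lambda>n. D n > max 0 (2 / e * (\<bar>E N\<bar> + e / 2 * \<bar>D N\<bar>))) sequentially"
    using D unfolding filterlim_at_top_dense by blast
  with eventually_ge_at_top[of N] show "eventually (\<lambda>n. dist (A n / D n) L < e) sequentially"
  proof eventually_elim
    case (elim n)
    have pos: "D n > 0"
      using elim(2) by linarith
    have "2 / e * (\<bar>E N\<bar> + e / 2 * \<bar>D N\<bar>) < D n"
      using elim(2) by linarith
    hence big: "\<bar>E N\<bar> + e / 2 * \<bar>D N\<bar> < e / 2 * D n"
      using e by (simp add: field_simps)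
    have "- (e / 2 * D N) \<le> e / 2 * \<bar>D N\<bar>"
      using e by (simp add: abs_if)
    moreover have "\<bar>E n\<bar> \<le> \<bar>E n - E N\<bar> + \<bar>E N\<bar>"
      by linarith
    ultimately have "\<bar>E n\<bar> < e * D n"
      using tele[OF elim(1)] big by (simp add: algebra_simps)
    moreover have "A n / D n - L = E n / D n"
      using pos by (simp add: E_def field_simps)
    ultimately show ?case
      using pos by (simp add: dist_real_def field_simps)
  qed
qed

text \<open>Both terms lie between \<open>p * x - x\<^sup>2\<close> and \<open>p * x\<close>, since
  they agree to first order. Square-summable arguments therefore give a convergent series of
  differences.\<close>

lemma abs_ln_one_plus_mult_diff_le:
  fixes x p :: real
  assumes "0 \<le> x" "x \<le> 1" "0 \<le> p" "p \<le> 1"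
  shows "\<bar>p * ln (1 + x) - ln (1 + p * x)\<bar> \<le> x\<^sup>2"
proof -
  have px: "0 \<le> p * x" "p * x \<le> 1"
    using assms by (auto simp: mult_le_one)
  have "p * (x - x\<^sup>2) \<le> p * ln (1 + x)" "p * ln (1 + x) \<le> p * x"
    using assms ln_one_plus_pos_lower_bound[of x] ln_add_one_self_le_self[of x]
    by (auto intro!: mult_left_mono)
  moreover have "p * x - (p * x)\<^sup>2 \<le> ln (1 + p * x)" "ln (1 + p * x) \<le> p * x"
    using px ln_one_plus_pos_lower_bound[of "p * x"] ln_add_one_self_le_self[of "p * x"] by auto
  moreover have "p * x\<^sup>2 \<le> x\<^sup>2" "(p * x)\<^sup>2 \<le> x\<^sup>2"
    using assms mult_right_mono[of p 1 "x\<^sup>2"] mult_right_mono[of p 1 x] by (auto intro!: power_mono)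
  ultimately show ?thesis
    by (simp add: abs_le_iff algebra_simps)
qed

lemma a_seq_pos:
  assumes "\<And>n. n \<ge> 1 \<Longrightarrow> mu n > 0" "0 \<le> p"
  shows "a_seq mu p n > 0"
  unfolding a_seq_def nu_seq_def
  using assms by (intro prod_pos) (auto intro!: add_pos_nonneg mult_nonneg_nonneg
    divide_nonneg_nonneg sum_nonneg simp: less_imp_le)

text \<open>
  Since \<open>1 + \<mu>\<^sub>i\<^sub>+\<^sub>1 / \<nu>\<^sub>i = \<nu>\<^sub>i\<^sub>+\<^sub>1 / \<nu>\<^sub>i\<close>, the product defining \<open>a\<^sub>n\<close> telescopes to
  \<open>\<nu>\<^sub>n powr (- p)\<close> up to factors \<open>1 + O((\<mu>\<^sub>i\<^sub>+\<^sub>1 / \<nu>\<^sub>i)\<^sup>2)\<close>.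
\<close>
lemma a_seq_mult_nu_seq_powr_tendsto:
  fixes mu :: "nat \<Rightarrow> real"
  assumes pos: "\<And>n. n \<ge> 1 \<Longrightarrow> mu n > 0" and p: "0 \<le> p" "p \<le> 1"
    and summ: "summable (\<lambda>i. (mu (Suc i) / nu_seq mu i)\<^sup>2)"
  shows "\<exists>C>0. (\<lambda>n. a_seq mu p n * nu_seq mu n powr p) \<longlonglongrightarrow> C"
proof -
  define x where "x i = mu (Suc i) / nu_seq mu i" for i
  \<comment> \<open>For \<open>i \<ge> 1\<close>, \<open>t i\<close> is the logarithm of the factor
    by which \<open>a_seq mu p n * nu_seq mu n powr p\<close> changes from \<open>n = i\<close> to
    \<open>n = i + 1\<close>.\<close>
  define t where "t i = p * ln (1 + x i) - ln (1 + p * x i)" for i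
  have nu_pos: "nu_seq mu n > 0" if "n \<ge> 1" for n
    unfolding nu_seq_def using that pos by (intro sum_pos) auto
  have nu_nonneg: "nu_seq mu n \<ge> 0" for n
    unfolding nu_seq_def using pos by (intro sum_nonneg) (auto simp: less_imp_le)
  have x_nonneg: "x i \<ge> 0" for i
    unfolding x_def using pos[of "Suc i"] nu_nonneg[of i] by simp
  have "(\<lambda>i. (x i)\<^sup>2) \<longlonglongrightarrow> 0"
    using summable_LIMSEQ_zero[OF summ] by (simp add: x_def)
  hence "eventually (\<lambda>i. (x i)\<^sup>2 < 1) sequentially"
    by (rule order_tendstoD) simp
  hence ev: "eventually (\<lambda>i. norm (t i) \<le> (x i)\<^sup>2) sequentially"
  proof eventually_elim
    case (elim i)
    hence "x i \<le> 1"
      using x_nonneg[of i] by (simp add: power2_less_1_iff abs_square_less_1)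
    thus ?case
      unfolding t_def real_norm_def using x_nonneg p by (intro abs_ln_one_plus_mult_diff_le)
  qed
  have "summable t"
    using summable_comparison_test_ev[OF ev] summ by (simp add: x_def)
  hence "(\<lambda>n. \<Sum>i<n. t i) \<longlonglongrightarrow> suminf t"
    by (rule summable_LIMSEQ)
  hence "(\<lambda>n. mu 1 powr p * exp (\<Sum>i<n. t i)) \<longlonglongrightarrow> mu 1 powr p * exp (suminf t)"
    by (intro tendsto_intros)
  moreover have "mu 1 powr p * exp (\<Sum>i<n. t i) = a_seq mu p n * nu_seq mu n powr p"
    if "n \<ge> 1" for n
    using that
  proof (induction n rule: dec_induct)
    case base
    \<comment> \<open>Since \<open>nu_seq mu 0 = 0\<close>, the convention for division by zero
      gives \<open>x 0 = 0\<close> and \<open>t 0 = 0\<close>. So the sum may start at 0 although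
      the product starts at 1.\<close>
    show ?case by (simp add: a_seq_def nu_seq_def t_def x_def)
  next
    case (step n)
    have px: "1 + p * x n > 0" and x1: "1 + x n > 0"
      using p x_nonneg[of n] by (auto intro!: add_pos_nonneg)
    have "exp (t n) = (1 + x n) powr p * inverse (1 + p * x n)"
      using px x1 by (simp add: t_def exp_diff powr_def divide_simps)
    moreover have "a_seq mu p (Suc n) = a_seq mu p n * inverse (1 + p * x n)"
      using step.hyps by (simp add: a_seq_def x_def)
    moreover have "nu_seq mu (Suc n) = nu_seq mu n * (1 + x n)"
      using nu_pos[OF step.hyps(1)] by (simp add: nu_seq_def x_def field_simps)
    moreover have "(nu_seq mu n * (1 + x n)) powr p = nu_seq mu n powr p * (1 + x n) powr p"
      using x1 nu_nonneg by (simp add: powr_mult)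
    ultimately show ?case
      using step.IH by (simp add: exp_add mult_ac)
  qed
  hence "eventually (\<lambda>n. mu 1 powr p * exp (\<Sum>i<n. t i) = a_seq mu p n * nu_seq mu n powr p) sequentially"
    by (auto simp: eventually_sequentially)
  ultimately have "(\<lambda>n. a_seq mu p n * nu_seq mu n powr p) \<longlonglongrightarrow> mu 1 powr p * exp (suminf t)"
    by (simp add: tendsto_cong)
  moreover have "mu 1 powr p * exp (suminf t) > 0"
    using pos[of 1] by simp
  ultimately show ?thesis by blast
qed

text \<open>A decreasing function with limit 0 is nonnegative, so its integral grows with the upper
  end, and over \<open>{x..y}\<close> by at most \<open>\<delta> x * (y - x)\<close>. With
  logarithms of consecutive integers as \<open>x\<close> and \<open>y\<close>, the second bound
  yields slow variation with error o(1/n).\<close>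

lemma exp_integral_quotient:
  fixes f \<delta> :: "real \<Rightarrow> real"
  assumes f: "\<And>x. x > b \<Longrightarrow> f x = exp (integral {b..x} \<delta>)"
    and int: "\<And>x. x > b \<Longrightarrow> \<delta> integrable_on {b..x}"
    and anti: "antimono_on {b<..} \<delta>" and lim: "(\<delta> \<longlongrightarrow> 0) at_top"
    and xy: "b < x" "x \<le> y"
  shows "f x \<le> f y" and "f x \<ge> f y * exp (- (\<delta> x * (y - x)))"
proof -
  have nonneg: "\<delta> z \<ge> 0" if "z > b" for z
  proof (rule tendsto_upperbound[OF lim])
    show "eventually (\<lambda>w. \<delta> w \<le> \<delta> z) at_top"
      using eventually_ge_at_top[of z]
      by eventually_elim (use anti that in \<open>auto simp: monotone_on_def\<close>)
  qed simp
  have comb: "integral {b..x} \<delta> + integral {x..y} \<delta> = integral {b..y} \<delta>"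
    using xy int[of y] by (intro Henstock_Kurzweil_Integration.integral_combine) auto
  have int': "\<delta> integrable_on {x..y}"
    using int[of y] xy by (auto intro: integrable_on_subinterval)
  have "integral {x..y} \<delta> \<ge> 0"
    using nonneg xy by (intro Henstock_Kurzweil_Integration.integral_nonneg int') auto
  with comb show "f x \<le> f y"
    using f xy by simp
  have "integral {x..y} \<delta> \<le> integral {x..y} (\<lambda>_. \<delta> x)"
    using anti xy by (intro integral_le int') (auto simp: monotone_on_def)
  also have "\<dots> = \<delta> x * (y - x)"
    using xy by simp
  finally show "f x \<ge> f y * exp (- (\<delta> x * (y - x)))"
    using f xy comb by (simp add: mult_exp_exp)
qed

text \<open>Formally, \<open>integral {1..ln u} F\<close> has derivative
  \<open>F (ln u) / u\<close>. Monotonicity of \<open>F\<close> replaces differentiation: it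
  squeezes the increment from \<open>n\<close> to \<open>n + 1\<close> between multiples of
  \<open>F (ln n) / n\<close> whose factors tend to 1. Stolz--Cesaro then compares the sum with the
  integral.\<close>

lemma sum_asymp_integral_of_ln:
  fixes F :: "real \<Rightarrow> real" and w :: "nat \<Rightarrow> real"
  assumes pos: "\<And>x. x \<ge> 0 \<Longrightarrow> F x > 0"
    and mono: "mono_on {b<..} F"
    and ratio: "(\<lambda>n. F (ln (real (Suc n))) / F (ln (real n))) \<longlonglongrightarrow> 1"
    and inf: "integral_infinite 1 F"
    and w: "(\<lambda>n. w n / (F (ln (real n)) / real n)) \<longlonglongrightarrow> C"
  shows "(\<lambda>n. (\<Sum>k=1..n. w k) / integral {1..ln (real n)} F) \<longlonglongrightarrow> C"
proof -
  define J where "J n = integral {1..ln (real n)} F" for n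
  have lnln: "filterlim (\<lambda>n. ln (real n)) at_top sequentially"
    by real_asymp
  have J: "filterlim J at_top sequentially"
    unfolding J_def
    using inf by (intro filterlim_compose[OF _ lnln]) (simp add: integral_infinite_def)
  \<comment> \<open>Above 1 the point \<open>ln n\<close> lies inside the interval of integration
    and splits it; above \<open>b\<close> the function \<open>F\<close> is monotone.\<close>
  have large: "eventually (\<lambda>n. ln (real n) > max 1 b \<and> n \<ge> 1) sequentially"
    using lnln unfolding filterlim_at_top_dense
    by (intro eventually_conj eventually_ge_at_top) blast
  have bounds: "F (ln (real n)) * ln (1 + 1 / real n) \<le> J (Suc n) - J n \<and>
      J (Suc n) - J n \<le> F (ln (real (Suc n))) * ln (1 + 1 / real n)"
    if n: "ln (real n) > max 1 b \<and> n \<ge> 1" for n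
  proof -
    define x y where "x = ln (real n)" and "y = ln (real (Suc n))"
    have xy: "x \<le> y" "x > 1" "x > b"
      using n by (auto simp: x_def y_def)
    have "1 + 1 / real n = real (Suc n) / real n"
      using n by (simp add: field_simps)
    hence d: "y - x = ln (1 + 1 / real n)"
      using n by (simp add: x_def y_def ln_div)
    have int: "F integrable_on {1..y}"
      using inf xy by (simp add: integral_infinite_def)
    have diff: "J (Suc n) - J n = integral {x..y} F"
      using Henstock_Kurzweil_Integration.integral_combine[OF _ _ int, of x] xy
      by (simp add: J_def x_def y_def)
    have int': "F integrable_on {x..y}"
      using int xy by (auto intro: integrable_on_subinterval)
    have F_mono: "F u \<le> F v" if "x \<le> u" "u \<le> v" for u v
      using that xy mono by (auto simp: monotone_on_def)
    have "integral {x..y} (\<lambda>_. F x) \<le> integral {x..y} F"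
      using F_mono by (intro integral_le int') auto
    moreover have "integral {x..y} F \<le> integral {x..y} (\<lambda>_. F y)"
      using F_mono by (intro integral_le int') auto
    ultimately show ?thesis
      using xy unfolding diff d[symmetric] by (simp add: x_def y_def mult.commute)
  qed
  define h where "h n = F (ln (real n)) / real n" for n
  define G where "G n = (J (Suc n) - J n) / h n" for n
  have h_pos: "h n > 0" if "n \<ge> 1" for n
    using that pos[of "ln (real n)"] by (simp add: h_def)
  have "G \<longlonglongrightarrow> 1"
  proof (rule tendsto_sandwich)
    show "eventually (\<lambda>n. real n * ln (1 + 1 / real n) \<le> G n) sequentially"
      using large
    proof eventually_elim
      case (elim n)
      have "F (ln (real n)) > 0" using elim by (intro pos) auto
      moreover have "real n * (F (ln (real n)) * ln (1 + 1 / real n)) \<le> real n * (J (Suc n) - J n)"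
        using bounds[OF elim] by (intro mult_left_mono) auto
      ultimately show ?case using elim by (simp add: G_def h_def field_simps)
    qed
    show "eventually (\<lambda>n. G n \<le> F (ln (real (Suc n))) / F (ln (real n)) *
        (real n * ln (1 + 1 / real n))) sequentially"
      using large
    proof eventually_elim
      case (elim n)
      have "F (ln (real n)) > 0" using elim by (intro pos) auto
      hence "real n * (J (Suc n) - J n) / F (ln (real n)) \<le>
          real n * (F (ln (real (Suc n))) * ln (1 + 1 / real n)) / F (ln (real n))"
        using bounds[OF elim] by (intro divide_right_mono mult_left_mono) auto
      thus ?case by (simp add: G_def h_def mult_ac)
    qed
    show *: "(\<lambda>n. real n * ln (1 + 1 / real n)) \<longlonglongrightarrow> 1"
      by real_asymp
    show "(\<lambda>n. F (ln (real (Suc n))) / F (ln (real n)) * (real n * ln (1 + 1 / real n))) \<longlonglongrightarrow> 1"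
      using tendsto_mult[OF ratio *] by simp
  qed
  \<comment> \<open>The partial sums grow by \<open>w (Suc n)\<close>, whereas the increment of
    \<open>J\<close> is compared with \<open>h n\<close>; the ratio \<open>h (Suc n) / h n\<close>
    bridges the shift of index.\<close>
  have "(\<lambda>n. w (Suc n) / h (Suc n)) \<longlonglongrightarrow> C"
    using LIMSEQ_Suc[OF w] by (simp add: h_def)
  moreover have "(\<lambda>n. h (Suc n) / h n) \<longlonglongrightarrow> 1"
  proof -
    have "(\<lambda>n. real n / real (Suc n)) \<longlonglongrightarrow> 1" by real_asymp
    from tendsto_mult[OF ratio this] show ?thesis by (simp add: h_def mult.commute)
  qed
  ultimately have "(\<lambda>n. w (Suc n) / h (Suc n) * (h (Suc n) / h n) / G n) \<longlonglongrightarrow> C * 1 / 1"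
    using \<open>G \<longlonglongrightarrow> 1\<close> by (intro tendsto_intros) auto
  moreover have "eventually (\<lambda>n. w (Suc n) / h (Suc n) * (h (Suc n) / h n) / G n =
      w (Suc n) / (J (Suc n) - J n)) sequentially"
    using eventually_ge_at_top[of 1]
  proof eventually_elim
    case (elim n)
    thus ?case using h_pos[of n] h_pos[of "Suc n"] by (simp add: G_def)
  qed
  ultimately have "(\<lambda>n. w (Suc n) / (J (Suc n) - J n)) \<longlonglongrightarrow> C"
    by (simp add: tendsto_cong)
  moreover from large have "eventually (\<lambda>n. J n < J (Suc n)) sequentially"
  proof eventually_elim
    case (elim n)
    have "F (ln (real n)) * ln (1 + 1 / real n) > 0"
      using elim by (intro mult_pos_pos pos ln_gt_zero) auto
    with bounds[OF elim] show ?case by linarith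
  qed
  ultimately show ?thesis
    using stolz_cesaro[OF J, of "\<lambda>n. \<Sum>k=1..n. w k" C] by (simp add: J_def)
qed

text \<open>
  A case of Karamata's theorem, with slow variation in the strong form
  \<open>L n / L (n + 1) = 1 + o(1/n)\<close> for which the Stolz--Cesaro theorem suffices.
\<close>
lemma nu_seq_over_tendsto:
  fixes mu L :: "nat \<Rightarrow> real"
  assumes mu: "\<And>n. n \<ge> 1 \<Longrightarrow> mu n = real n powr \<gamma> * L n"
    and L: "\<And>n. n \<ge> 1 \<Longrightarrow> L n > 0"
    and mono: "eventually (\<lambda>n. L n \<le> L (Suc n)) sequentially"
    and slow: "(\<lambda>n. real n * (1 - L n / L (Suc n))) \<longlonglongrightarrow> 0" and \<gamma>: "\<gamma> > -1"
  shows "(\<lambda>n. nu_seq mu n / (real n * mu n)) \<longlonglongrightarrow> 1 / (\<gamma> + 1)"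
proof (rule stolz_cesaro)
  define U where "U n = real n * mu n" for n
  have mu_pos: "mu n > 0" if "n \<ge> 1" for n
    using that mu L by simp
  \<comment> \<open>The reciprocal of the Stolz--Cesaro quotient,
    \<open>(U (Suc n) - U n) / mu (Suc n)\<close>, is split by writing
    \<open>L n / L (Suc n)\<close> as 1 minus its defect. The pure power part tends to
    \<open>\<gamma> + 1\<close>, and the rest vanishes by \<open>slow\<close>.\<close>
  have "(\<lambda>n. real n + 1 - real n * (real n / (real n + 1)) powr \<gamma>) \<longlonglongrightarrow> \<gamma> + 1"
    by real_asymp
  moreover have "(\<lambda>n. (real n / (real n + 1)) powr \<gamma>) \<longlonglongrightarrow> 1"
    by real_asymp
  ultimately have "(\<lambda>n. (real n + 1 - real n * (real n / (real n + 1)) powr \<gamma>) +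
      (real n / (real n + 1)) powr \<gamma> * (real n * (1 - L n / L (Suc n)))) \<longlonglongrightarrow> (\<gamma> + 1) + 1 * 0"
    by (intro tendsto_add tendsto_mult slow)
  moreover have "eventually (\<lambda>n. (real n + 1 - real n * (real n / (real n + 1)) powr \<gamma>) +
      (real n / (real n + 1)) powr \<gamma> * (real n * (1 - L n / L (Suc n))) =
      (U (Suc n) - U n) / mu (Suc n)) sequentially"
    using eventually_ge_at_top[of 1]
  proof eventually_elim
    case (elim n)
    have "mu n / mu (Suc n) = (real n / (real n + 1)) powr \<gamma> * (L n / L (Suc n))"
      using elim by (simp add: mu powr_divide add.commute)
    moreover have "(U (Suc n) - U n) / mu (Suc n) = real n + 1 - real n * (mu n / mu (Suc n))"
      using mu_pos[of "Suc n"] by (simp add: U_def field_simps)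
    ultimately show ?case
      by (simp add: algebra_simps)
  qed
  ultimately have lim: "(\<lambda>n. (U (Suc n) - U n) / mu (Suc n)) \<longlonglongrightarrow> \<gamma> + 1"
    by (simp add: tendsto_cong)
  \<comment> \<open>The positivity of this limit also makes \<open>n * mu n\<close> eventually
    increasing, even where \<open>\<gamma> < 0\<close> and \<open>mu\<close> itself may
    decrease.\<close>
  have "eventually (\<lambda>n. (U (Suc n) - U n) / mu (Suc n) > 0) sequentially"
    using order_tendstoD(1)[OF lim, of 0] \<gamma> by simp
  thus "eventually (\<lambda>n. real n * mu n < real (Suc n) * mu (Suc n)) sequentially"
  proof eventually_elim
    case (elim n)
    thus ?case using mu_pos[of "Suc n"] by (simp add: U_def zero_less_divide_iff)
  qed
  show "filterlim (\<lambda>n. real n * mu n) at_top sequentially"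
  proof -
    from mono obtain N where N: "\<And>n. n \<ge> N \<Longrightarrow> L n \<le> L (Suc n)"
      by (auto simp: eventually_sequentially)
    \<comment> \<open>Taking \<open>M\<close> at least 1 ensures \<open>L M > 0\<close>, which is
      then a lower bound for \<open>L\<close> from \<open>M\<close> on.\<close>
    define M where "M = max N 1"
    have LM: "L M \<le> L n" if "n \<ge> M" for n
      using that
    proof (induction n rule: dec_induct)
      case (step n)
      have "L n \<le> L (Suc n)" using step.hyps by (intro N) (simp add: M_def)
      with step.IH show ?case by simp
    qed simp
    have "filterlim (\<lambda>n. real n powr (\<gamma> + 1)) at_top sequentially"
      using \<gamma> by real_asymp
    hence "filterlim (\<lambda>n. L M * real n powr (\<gamma> + 1)) at_top sequentially"
      using L[of M] by (intro filterlim_tendsto_pos_mult_at_top[OF tendsto_const]) (auto simp: M_def)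
    thus ?thesis
    proof (rule filterlim_at_top_mono)
      show "eventually (\<lambda>n. L M * real n powr (\<gamma> + 1) \<le> real n * mu n) sequentially"
        using eventually_ge_at_top[of M]
      proof eventually_elim
        case (elim n)
        hence n: "n \<ge> 1" by (simp add: M_def)
        have "L M * real n powr (\<gamma> + 1) \<le> L n * real n powr (\<gamma> + 1)"
          using LM[OF elim] by (intro mult_right_mono) auto
        also have "\<dots> = real n * mu n"
          using n by (simp add: mu powr_add)
        finally show ?case .
      qed
    qed
  qed
  have "(\<lambda>n. inverse ((U (Suc n) - U n) / mu (Suc n))) \<longlonglongrightarrow> inverse (\<gamma> + 1)"
    using lim \<gamma> by (intro tendsto_inverse) auto
  thus "(\<lambda>n. (nu_seq mu (Suc n) - nu_seq mu n) /
      (real (Suc n) * mu (Suc n) - real n * mu n)) \<longlonglongrightarrow> 1 / (\<gamma> + 1)"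
    by (simp add: U_def nu_seq_def inverse_eq_divide)
qed

theorem theorem4p28:
  fixes \<mu> l f \<delta> :: "real \<Rightarrow> real" and \<gamma> \<rho> B p :: real and m :: nat
    and mu :: "nat \<Rightarrow> real"
  assumes "\<gamma> > -1"
    and "assumption_B \<mu> \<gamma> l f B \<delta> \<rho> m"
    and "\<And>n. mu n = \<mu> (real n)"
    and "p = p_crit \<gamma>" and "0 \<le> p" and "p \<le> 1"
  shows "\<exists>C>0.
    (\<lambda>n. (a_seq mu p n)\<^sup>2 * (mu n)\<^sup>2)
      \<sim>[sequentially] (\<lambda>n. C * (l (real n) powr (1 / (\<gamma> + 1)) / real n)) \<and>
    (integral_infinite 1 (\<lambda>s. f s powr (1 / (\<gamma> + 1))) \<longrightarrow>
      (\<lambda>n. (v_seq mu p n)\<^sup>2)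
        \<sim>[sequentially] (\<lambda>n. C * integral {1..ln (real n)} (\<lambda>s. f s powr (1 / (\<gamma> + 1)))) \<and>
      (\<lambda>n. (sigma_seq mu p n)\<^sup>2)
        \<sim>[sequentially] (\<lambda>n. real n * l (real n) powr (- (1 / (\<gamma> + 1))) *
          integral {1..ln (real n)} (\<lambda>s. f s powr (1 / (\<gamma> + 1)))))"
proof -

  \<comment> \<open>Positivity, exponent identities and bounds for \<open>f\<close>\<close>
  have \<mu>: "\<And>x. x \<ge> 1 \<Longrightarrow> \<mu> x > 0" "\<And>x. x \<ge> 1 \<Longrightarrow> \<mu> x = x powr \<gamma> * l x"
    and l_f: "\<And>x. x \<ge> 1 \<Longrightarrow> l x = f (ln x)"
    and f_exp: "\<And>x. x > ln B \<Longrightarrow> f x = exp (integral {ln B..x} \<delta>)"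
    and \<delta>: "antimono_on {ln B<..} \<delta>" "(\<delta> \<longlongrightarrow> 0) at_top"
      "\<And>x. x > ln B \<Longrightarrow> \<delta> integrable_on {ln B..x}"
    using assms(2) unfolding assumption_B_def by blast+
  define q where "q = 1 / (\<gamma> + 1)"
  define L where "L n = l (real n)" for n
  have q: "q > 0"
    using assms(1) by (simp add: q_def)
  \<comment> \<open>The critical value enters through these two identities:
    \<open>2 - 2 * p = q\<close> will be the exponent of \<open>L\<close>, and
    \<open>2 * \<gamma> - (\<gamma> + 1) * (2 * p) = -1\<close> that of \<open>n\<close>.\<close>
  have two_p: "2 * p = 2 - q"
    using assms(1,4) by (simp add: q_def p_crit_def divide_simps) (simp add: algebra_simps)
  have two_p': "(\<gamma> + 1) * (2 * p) = 2 * \<gamma> + 1"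
    using assms(1,4) by (simp add: p_crit_def field_simps)
  have l_pos: "l x > 0" if "x \<ge> 1" for x
    using \<mu>[OF that] that by (simp add: zero_less_mult_iff)
  \<comment> \<open>Positivity is drawn from \<open>l\<close> at \<open>exp x\<close>, because the
    exponential formula for \<open>f\<close> covers only \<open>x > ln B\<close>.\<close>
  have f_pos: "f x > 0" if "x \<ge> 0" for x
    using l_f[of "exp x"] l_pos[of "exp x"] that by simp
  have L_eq: "L n = f (ln (real n))" if "n \<ge> 1" for n
    using that by (simp add: L_def l_f)
  have L_pos: "L n > 0" if "n \<ge> 1" for n
    using that by (simp add: L_def l_pos)
  have mu_eq: "mu n = real n powr \<gamma> * L n" if "n \<ge> 1" for n
    using \<mu>(2) assms(3) that by (simp add: L_def)
  have mu_pos: "mu n > 0" if "n \<ge> 1" for n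
    using \<mu>(1) assms(3) that by simp
  have f_quot: "f x \<le> f y" "f x \<ge> f y * exp (- (\<delta> x * (y - x)))" if "ln B < x" "x \<le> y" for x y
    using exp_integral_quotient[of "ln B" f \<delta> x y] f_exp \<delta> that by auto

  \<comment> \<open>Slow variation along the integers\<close>
  have lnln: "filterlim (\<lambda>n. ln (real n)) at_top sequentially"
    by real_asymp
  have large: "eventually (\<lambda>n. ln (real n) > ln B \<and> n \<ge> 1) sequentially"
    using lnln unfolding filterlim_at_top_dense
    by (intro eventually_conj eventually_ge_at_top) blast
  have L_mono: "eventually (\<lambda>n. L n \<le> L (Suc n)) sequentially"
    using large by eventually_elim (auto simp: L_eq intro!: f_quot(1))
  \<comment> \<open>The lower bound for \<open>f (ln n)\<close> in terms of
    \<open>f (ln (n + 1))\<close> and \<open>1 - exp (- d) \<le> d\<close> bound the defect by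
    \<open>\<delta> (ln n)\<close> times the logarithmic step, which is asymptotic to 1/n; and
    \<open>\<delta> (ln n)\<close> tends to 0.\<close>
  have slow: "(\<lambda>n. real n * (1 - L n / L (Suc n))) \<longlonglongrightarrow> 0"
  proof (rule tendsto_sandwich)
    show "eventually (\<lambda>n. 0 \<le> real n * (1 - L n / L (Suc n))) sequentially"
      using L_mono
    proof eventually_elim
      case (elim n)
      thus ?case using L_pos[of "Suc n"] by simp
    qed
    show "eventually (\<lambda>n. real n * (1 - L n / L (Suc n)) \<le>
        \<delta> (ln (real n)) * (real n * (ln (real (Suc n)) - ln (real n)))) sequentially"
      using large
    proof eventually_elim
      case (elim n)
      define d where "d = \<delta> (ln (real n)) * (ln (real (Suc n)) - ln (real n))"
      have "L n \<ge> L (Suc n) * exp (- d)"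
        using elim f_quot(2)[of "ln (real n)" "ln (real (Suc n))"] by (simp add: L_eq d_def)
      hence "L n / L (Suc n) \<ge> exp (- d)"
        using L_pos[of "Suc n"] by (simp add: field_simps)
      with exp_ge_add_one_self[of "- d"] have "1 - L n / L (Suc n) \<le> d"
        by linarith
      hence "real n * (1 - L n / L (Suc n)) \<le> real n * d"
        by (intro mult_left_mono) auto
      thus ?case by (simp add: d_def mult_ac)
    qed
    have "(\<lambda>n. \<delta> (ln (real n))) \<longlonglongrightarrow> 0"
      by (intro filterlim_compose[OF \<delta>(2) lnln])
    moreover have "(\<lambda>n. real n * (ln (real (Suc n)) - ln (real n))) \<longlonglongrightarrow> 1"
      by real_asymp
    ultimately show "(\<lambda>n. \<delta> (ln (real n)) * (real n * (ln (real (Suc n)) - ln (real n)))) \<longlonglongrightarrow> 0"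
      using tendsto_mult by fastforce
  qed auto
  have L_ratio: "(\<lambda>n. L (Suc n) / L n) \<longlonglongrightarrow> 1"
  proof -
    have "(\<lambda>n. 1 - real n * (1 - L n / L (Suc n)) * (1 / real n)) \<longlonglongrightarrow> 1 - 0 * 0"
      by (intro tendsto_intros slow lim_1_over_n)
    moreover have "eventually (\<lambda>n. 1 - real n * (1 - L n / L (Suc n)) * (1 / real n) =
        L n / L (Suc n)) sequentially"
      using eventually_ge_at_top[of 1] by eventually_elim auto
    ultimately have "(\<lambda>n. L n / L (Suc n)) \<longlonglongrightarrow> 1"
      by (simp add: tendsto_cong)
    from tendsto_inverse[OF this] show ?thesis by simp
  qed

  \<comment> \<open>Asymptotics of \<open>nu_seq\<close> and \<open>a_seq\<close>\<close>
  define U where "U n = real n * mu n" for n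
  have nu_U: "(\<lambda>n. nu_seq mu n / U n) \<longlonglongrightarrow> q"
    unfolding U_def q_def
    using mu_eq L_pos L_mono slow assms(1) by (intro nu_seq_over_tendsto) auto
  have nu_pos: "nu_seq mu n > 0" if "n \<ge> 1" for n
    unfolding nu_seq_def using that mu_pos by (intro sum_pos) auto
  \<comment> \<open>The product equals \<open>n * mu (n + 1) / nu_seq mu n\<close>, factored through
    \<open>mu n\<close>. Its finite limit gives a ratio of order 1/n, whose squares are
    summable.\<close>
  have "(\<lambda>n. (1 + 1 / real n) powr \<gamma> * (L (Suc n) / L n) * inverse (nu_seq mu n / U n))
      \<longlonglongrightarrow> 1 * 1 * inverse q"
  proof (intro tendsto_mult tendsto_inverse L_ratio nu_U)
    show "(\<lambda>n. (1 + 1 / real n) powr \<gamma>) \<longlonglongrightarrow> 1" by real_asymp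
  qed (use q in auto)
  moreover have "eventually (\<lambda>n. (1 + 1 / real n) powr \<gamma> * (L (Suc n) / L n) *
      inverse (nu_seq mu n / U n) = (mu (Suc n) / nu_seq mu n) / (1 / real n)) sequentially"
    using eventually_ge_at_top[of 1]
  proof eventually_elim
    case (elim n)
    have "1 + 1 / real n = real (Suc n) / real n"
      using elim by (simp add: field_simps)
    hence "mu (Suc n) / mu n = (1 + 1 / real n) powr \<gamma> * (L (Suc n) / L n)"
      using elim by (simp add: mu_eq powr_divide)
    thus ?case
      using elim mu_pos[of n] by (simp add: U_def field_simps)
  qed
  ultimately have "(\<lambda>n. (mu (Suc n) / nu_seq mu n) / (1 / real n)) \<longlonglongrightarrow> inverse q"
    by (simp add: tendsto_cong)
  hence "(\<lambda>n. mu (Suc n) / nu_seq mu n) \<in> O(\<lambda>n. 1 / real n)"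
    using eventually_ge_at_top[of 1]
    by (intro bigoI_tendsto) (auto elim!: eventually_mono)
  hence "(\<lambda>n. (mu (Suc n) / nu_seq mu n)\<^sup>2) \<in> O(\<lambda>n. (1 / real n)\<^sup>2)"
    by (rule landau_o.big_power)
  moreover have "summable (\<lambda>n. norm ((1 / real n)\<^sup>2))"
    using inverse_power_summable[of 2, where ?'a = real] by (simp add: power_divide inverse_eq_divide)
  ultimately have "summable (\<lambda>n. (mu (Suc n) / nu_seq mu n)\<^sup>2)"
    by (rule summable_comparison_test_bigo[rotated])
  from a_seq_mult_nu_seq_powr_tendsto[OF mu_pos assms(5,6) this]
  obtain C0 where C0: "C0 > 0" "(\<lambda>n. a_seq mu p n * nu_seq mu n powr p) \<longlonglongrightarrow> C0"
    by auto

  \<comment> \<open>The asymptotics of \<open>a_n^2 mu_n^2\<close>\<close>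
  define C where "C = C0\<^sup>2 * q powr (- (2 * p))"
  have C: "C > 0"
    using C0 q by (simp add: C_def)
  define w where "w n = (a_seq mu p n)\<^sup>2 * (mu n)\<^sup>2" for n
  have w_pos: "w n > 0" if "n \<ge> 1" for n
    using that mu_pos[of n] a_seq_pos[of mu p n, OF mu_pos assms(5)] by (simp add: w_def)
  \<comment> \<open>The constant \<open>C\<close> collects the limit \<open>C0\<close> of
    \<open>a_n * nu_n powr p\<close>, squared, and the factor \<open>q powr (- (2 * p))\<close> from
    replacing \<open>nu_n\<close> by \<open>q * U n\<close>.\<close>
  have "(\<lambda>n. (a_seq mu p n * nu_seq mu n powr p)\<^sup>2 * (nu_seq mu n / U n) powr (- (2 * p))) \<longlonglongrightarrow> C"
    unfolding C_def using q
    by (intro tendsto_mult tendsto_power tendsto_powr C0 nu_U tendsto_const) auto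
  moreover have "eventually (\<lambda>n. (a_seq mu p n * nu_seq mu n powr p)\<^sup>2 *
      (nu_seq mu n / U n) powr (- (2 * p)) = w n / (L n powr q / real n)) sequentially"
    using eventually_ge_at_top[of 1]
  proof eventually_elim
    case (elim n)
    note pos = nu_pos[OF elim] L_pos[OF elim]
    have U: "U n = real n powr (\<gamma> + 1) * L n"
      using elim by (simp add: U_def mu_eq powr_add)
    \<comment> \<open>Splitting \<open>(L n)\<^sup>2\<close> lets \<open>L n powr (2 * p)\<close>
      join the power of \<open>n\<close> to form \<open>U n powr (2 * p)\<close>, which cancels;
      only \<open>L n powr q\<close> remains.\<close>
    have "(mu n)\<^sup>2 * real n = real n powr (2 * \<gamma> + 1) * (L n)\<^sup>2"
      using elim by (simp add: mu_eq power_mult_distrib powr_add powr_power mult_ac)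
    also have "(L n)\<^sup>2 = L n powr (2 * p) * L n powr q"
      using pos by (simp add: two_p flip: powr_add)
    also have "real n powr (2 * \<gamma> + 1) * (L n powr (2 * p) * L n powr q) =
        U n powr (2 * p) * L n powr q"
      using elim pos by (simp add: U powr_mult powr_powr two_p')
    finally have mu2: "(mu n)\<^sup>2 * real n = U n powr (2 * p) * L n powr q" .
    have "(nu_seq mu n powr p)\<^sup>2 * (nu_seq mu n / U n) powr (- (2 * p)) = U n powr (2 * p)"
      using elim pos U by (simp add: powr_minus powr_divide powr_power field_simps)
    hence "(a_seq mu p n * nu_seq mu n powr p)\<^sup>2 * (nu_seq mu n / U n) powr (- (2 * p)) =
        (a_seq mu p n)\<^sup>2 * U n powr (2 * p)"
      by (simp add: power_mult_distrib)
    moreover have "w n / (L n powr q / real n) = (a_seq mu p n)\<^sup>2 * ((mu n)\<^sup>2 * real n) / L n powr q"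
      by (simp add: w_def)
    ultimately show ?case
      using pos unfolding mu2 by simp
  qed
  ultimately have w_lim: "(\<lambda>n. w n / (L n powr q / real n)) \<longlonglongrightarrow> C"
    by (simp add: tendsto_cong)

  \<comment> \<open>Comparison of \<open>v_n^2\<close> with the integral\<close>
  define F where "F s = f s powr q" for s
  define J where "J n = integral {1..ln (real n)} F" for n
  have v_sq: "(v_seq mu p n)\<^sup>2 = (\<Sum>k=1..n. w k)" for n
    unfolding v_seq_def w_def by (simp add: sum_nonneg)
  have v_lim: "(\<lambda>n. (v_seq mu p n)\<^sup>2 / J n) \<longlonglongrightarrow> C" if "integral_infinite 1 F"
    unfolding v_sq J_def
  proof (rule sum_asymp_integral_of_ln[OF _ _ _ that])
    show "F x > 0" if "x \<ge> 0" for x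
      using f_pos[OF that] by (simp add: F_def)
    \<comment> \<open>Beyond 0 the values of \<open>f\<close> are known to be positive, and beyond
      \<open>ln B\<close> they increase.\<close>
    show "mono_on {max 0 (ln B)<..} F"
    proof (rule mono_onI)
      fix x y assume "x \<in> {max 0 (ln B)<..}" "x \<le> y"
      thus "F x \<le> F y"
        unfolding F_def using q f_pos[of x] by (intro powr_mono2 f_quot(1)) auto
    qed
    have "(\<lambda>n. (L (Suc n) / L n) powr q) \<longlonglongrightarrow> 1 powr q"
      by (intro tendsto_powr L_ratio tendsto_const) auto
    moreover have "eventually (\<lambda>n. (L (Suc n) / L n) powr q =
        F (ln (real (Suc n))) / F (ln (real n))) sequentially"
      using eventually_ge_at_top[of 1]
    proof eventually_elim
      case (elim n)
      thus ?case
        using L_pos[of n] L_pos[of "Suc n"] by (simp add: F_def powr_divide L_eq)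
    qed
    ultimately show "(\<lambda>n. F (ln (real (Suc n))) / F (ln (real n))) \<longlonglongrightarrow> 1"
      by (simp add: tendsto_cong)
    have "eventually (\<lambda>n. w n / (L n powr q / real n) = w n / (F (ln (real n)) / real n)) sequentially"
      using eventually_ge_at_top[of 1] by eventually_elim (simp add: F_def L_eq)
    from w_lim show "(\<lambda>n. w n / (F (ln (real n)) / real n)) \<longlonglongrightarrow> C"
      by (rule Lim_transform_eventually) fact
  qed

  \<comment> \<open>The asymptotic equivalences\<close>
  have w_equiv: "w \<sim>[sequentially] (\<lambda>n. C * (L n powr q / real n))"
    using w_lim C by (intro asymp_equivI'_const) auto
  have "(\<lambda>n. (v_seq mu p n)\<^sup>2) \<sim>[sequentially] (\<lambda>n. C * J n) \<and>
      (\<lambda>n. (sigma_seq mu p n)\<^sup>2) \<sim>[sequentially] (\<lambda>n. real n * L n powr (- q) * J n)"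
    if inf: "integral_infinite 1 F"
  proof
    show v_equiv: "(\<lambda>n. (v_seq mu p n)\<^sup>2) \<sim>[sequentially] (\<lambda>n. C * J n)"
      using v_lim[OF inf] C by (intro asymp_equivI'_const) auto
    \<comment> \<open>The denominator of \<open>sigma_seq\<close>, squared, is exactly
      \<open>w n\<close>, so the two equivalences can be divided and \<open>C\<close>
      cancels.\<close>
    have sigma_sq: "(sigma_seq mu p n)\<^sup>2 = (v_seq mu p n)\<^sup>2 / w n" for n
      by (simp add: sigma_seq_def w_def power_divide power_mult_distrib)
    have "(\<lambda>n. (sigma_seq mu p n)\<^sup>2) \<sim>[sequentially] (\<lambda>n. C * J n / (C * (L n powr q / real n)))"
      unfolding sigma_sq by (intro asymp_equiv_intros v_equiv w_equiv)
    \<comment> \<open>This is an equality of functions, valid also at \<open>n = 0\<close>, where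
      both sides are 0 by the convention for division.\<close>
    also have "(\<lambda>n. C * J n / (C * (L n powr q / real n))) = (\<lambda>n. real n * L n powr (- q) * J n)"
      using C by (simp add: powr_minus field_simps)
    finally show "(\<lambda>n. (sigma_seq mu p n)\<^sup>2) \<sim>[sequentially] (\<lambda>n. real n * L n powr (- q) * J n)" .
  qed
  with w_equiv C show ?thesis
    unfolding w_def[abs_def] L_def J_def F_def[abs_def] q_def by blast
qed

end
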